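(* Let $n\ge 1$ and $d\ge 1$ be integers. For any absolute value $\phi$ on $\mathbb{N}^n$, the closure of the cone $\sum \mathbb{R}[\underline{X}]^{2d}$ in $\mathbb{R}[\underline{X}]$ in the topology induced by the $\phi$-seminorm is equal to $\operatorname{Pos}(\mathcal{K}_{\phi})$.
   Context: $\mathbb{N}=\{0,1,2,\dots\}$, $\mathbb{R}[\underline{X}]=\mathbb{R}[X_1,\dots,X_n]$, and $\underline{X}^s=X_1^{s_1}\cdots X_n^{s_n}$ for $s=(s_1,\dots,s_n)\in\mathbb{N}^n$ (similarly $\underline{x}^s$ for $\underline{x}\in\mathbb{R}^n$). $\sum \mathbb{R}[\underline{X}]^{2d}$ is the set of all finite sums of $2d$-th powers of elements of $\mathbb{R}[\underline{X}]$. An absolute value on $\mathbb{N}^n$ is a function $\phi:\mathbb{N}^n\to\mathbb{R}_{\ge 0}$ such that $\phi(0)\ge 1$ and $\phi(s+t)\le\phi(s)\phi(t)$ for all $s,t\in\mathbb{N}^n$. For $f=\sum_s f_s\underline{X}^s\in\mathbb{R}[\underline{X}]$, the $\phi$-seminorm is $\|f\|_{\phi}:=\sum_s|f_s|\phi(s)$ (the induced topology need not be Hausdorff). $\mathcal{K}_{\phi}:=\{\underline{x}\in\mathbb{R}^n : |\underline{x}^s|\le\phi(s)\ \forall s\in\mathbb{N}^n\}$ and $\operatorname{Pos}(\mathcal{K}_{\phi}):=\{f\in\mathbb{R}[\underline{X}] : f\ge 0 \text{ on } \mathcal{K}_{\phi}\}$. *)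

theory Defs
  imports "HOL-Analysis.Analysis" "HOL-Library.Poly_Mapping"
begin

text \<open>
  The index type \<open>'n\<close> plays the role of \<open>{1, \<dots>, n}\<close> with \<open>n = CARD('n) \<ge> 1\<close>.
  Exponents are vectors in \<open>nat ^ 'n\<close>, so that the convolution product of \<open>Poly_Mapping\<close>
  makes \<open>(nat ^ 'n) \<Rightarrow>\<^sub>0 real\<close> the polynomial ring in \<open>n\<close> variables.
\<close>

type_synonym 'n rpoly = "(nat ^ 'n) \<Rightarrow>\<^sub>0 real"

definition monomial_eval :: "real ^ 'n \<Rightarrow> nat ^ 'n \<Rightarrow> real" where
  "monomial_eval x s = (\<Prod>i\<in>UNIV. (x $ i) ^ (s $ i))"

definition poly_eval :: "'n rpoly \<Rightarrow> real ^ 'n \<Rightarrow> real" where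
  "poly_eval f x = (\<Sum>s\<in>Poly_Mapping.keys f. Poly_Mapping.lookup f s * monomial_eval x s)"

definition sums_of_powers :: "nat \<Rightarrow> 'a::comm_semiring_1 set" where
  "sums_of_powers m = {\<Sum>i<k. g i ^ m | (k::nat) g. True}"

definition absolute_value :: "(nat ^ 'n \<Rightarrow> real) \<Rightarrow> bool" where
  "absolute_value \<phi> \<longleftrightarrow>
     (\<forall>s. \<phi> s \<ge> 0) \<and> \<phi> 0 \<ge> 1 \<and> (\<forall>s t. \<phi> (s + t) \<le> \<phi> s * \<phi> t)"

definition phi_seminorm :: "(nat ^ 'n \<Rightarrow> real) \<Rightarrow> 'n rpoly \<Rightarrow> real" where
  "phi_seminorm \<phi> f = (\<Sum>s\<in>Poly_Mapping.keys f. \<bar>Poly_Mapping.lookup f s\<bar> * \<phi> s)"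

definition phi_topology :: "(nat ^ 'n \<Rightarrow> real) \<Rightarrow> 'n rpoly topology" where
  "phi_topology \<phi> =
     topology (\<lambda>U. \<forall>f\<in>U. \<exists>e>0. \<forall>g. phi_seminorm \<phi> (g - f) < e \<longrightarrow> g \<in> U)"

text \<open>The predicate defines a topology whatever \<open>\<phi>\<close> is, so \<open>openin\<close> is as intended.\<close>

lemma openin_phi_topology:
  "openin (phi_topology \<phi>) U \<longleftrightarrow>
     (\<forall>f\<in>U. \<exists>e>0. \<forall>g. phi_seminorm \<phi> (g - f) < e \<longrightarrow> g \<in> U)"
proof -
  have "istopology (\<lambda>U. \<forall>f\<in>U. \<exists>e>0. \<forall>g. phi_seminorm \<phi> (g - f) < e \<longrightarrow> g \<in> U)"
    unfolding istopology_def
  proof (intro conjI allI impI ballI)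
    fix S T f
    assume S: "\<forall>f\<in>S. \<exists>e>0. \<forall>g. phi_seminorm \<phi> (g - f) < e \<longrightarrow> g \<in> S"
      and T: "\<forall>f\<in>T. \<exists>e>0. \<forall>g. phi_seminorm \<phi> (g - f) < e \<longrightarrow> g \<in> T"
      and f: "f \<in> S \<inter> T"
    obtain a where a: "a > 0" "\<forall>g. phi_seminorm \<phi> (g - f) < a \<longrightarrow> g \<in> S" using S f by blast
    obtain b where b: "b > 0" "\<forall>g. phi_seminorm \<phi> (g - f) < b \<longrightarrow> g \<in> T" using T f by blast
    show "\<exists>e>0. \<forall>g. phi_seminorm \<phi> (g - f) < e \<longrightarrow> g \<in> S \<inter> T"
      using a b by (intro exI[of _ "min a b"]) auto
  next
    fix \<K> f
    assume "\<forall>K\<in>\<K>. \<forall>f\<in>K. \<exists>e>0. \<forall>g. phi_seminorm \<phi> (g - f) < e \<longrightarrow> g \<in> K"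
      and "f \<in> \<Union>\<K>"
    then show "\<exists>e>0. \<forall>g. phi_seminorm \<phi> (g - f) < e \<longrightarrow> g \<in> \<Union>\<K>"
      by (meson UnionE UnionI)
  qed
  then show ?thesis
    by (simp add: phi_topology_def topology_inverse')
qed

lemma topspace_phi_topology: "topspace (phi_topology \<phi>) = UNIV"
proof -
  have "openin (phi_topology \<phi>) UNIV"
    unfolding openin_phi_topology by (auto intro: exI[of _ 1])
  then show ?thesis
    using openin_subset by blast
qed

definition K_set :: "(nat ^ 'n \<Rightarrow> real) \<Rightarrow> (real ^ 'n) set" where
  "K_set \<phi> = {x. \<forall>s. \<bar>monomial_eval x s\<bar> \<le> \<phi> s}"

definition Pos :: "(real ^ 'n) set \<Rightarrow> 'n rpoly set" where
  "Pos K = {f. \<forall>x\<in>K. poly_eval f x \<ge> 0}"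

end

theory Submission
  imports Defs
begin

text \<open>
  The closure \<open>C\<close> of the sums of \<open>2d\<close>-th powers is a cone closed under products. It is
  archimedean: \<open>(1 - b) ^ m = 1 - m b + O(\<parallel>b\<parallel>\<^sup>2)\<close> shows that a constant multiple of \<open>\<parallel>a\<parallel>\<close> minus \<open>a\<close>
  is an \<open>m\<close>-th power up to an error of half the size of \<open>a\<close>, and the error can be treated in the
  same way. If \<open>f \<notin> C\<close>, then \<open>C - f C\<close> does not contain \<open>-1\<close>; a maximal such \<open>C\<close>-module \<open>P\<close>
  satisfies \<open>P \<union> -P = A\<close>, and the cut it defines on the constants is a
  homomorphism \<open>L\<close> to the reals, nonnegative on \<open>C\<close>, with \<open>L f \<le> 0\<close>. Since \<open>C\<close> is archimedean and
  \<open>L\<close> multiplicative, \<open>\<bar>L a\<bar> \<le> \<parallel>a\<parallel>\<close>, so \<open>L\<close> is the evaluation at a point of \<open>K\<^sub>\<phi>\<close>. Applying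
  this to \<open>f + \<epsilon>\<close> for small \<open>\<epsilon> > 0\<close> shows that \<open>f\<close> is negative somewhere on \<open>K\<^sub>\<phi>\<close>.
\<close>

section \<open>Archimedean cones in commutative real algebras\<close>

text \<open>The homomorphism \<open>c\<close> is the structure map of a real algebra.\<close>

locale real_scalars =
  fixes c :: "real \<Rightarrow> 'a::comm_ring_1"
  assumes c_add: "c (x + y) = c x + c y"
    and c_mult: "c (x * y) = c x * c y"
    and c_1: "c 1 = 1"
begin

lemma c_0: "c 0 = 0"
  using c_add[of 0 0] by simp

lemma c_minus: "c (- x) = - c x"
  using c_add[of x "- x"] by (simp add: c_0 eq_neg_iff_add_eq_0 add.commute)

lemma c_diff: "c (x - y) = c x - c y"
  using c_add[of x "- y"] by (simp add: c_minus)

lemma c_cancel: "r \<noteq> 0 \<Longrightarrow> c r * (c (1 / r) * a) = a"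
  by (simp add: mult.assoc[symmetric] c_mult[symmetric] c_1)

definition character :: "('a \<Rightarrow> real) \<Rightarrow> bool" where
  "character L \<longleftrightarrow> (\<forall>a b. L (a + b) = L a + L b) \<and> (\<forall>a b. L (a * b) = L a * L b) \<and> (\<forall>r. L (c r) = r)"

end

locale archimedean_cone = real_scalars +
  fixes C
  assumes C_add: "a \<in> C \<Longrightarrow> b \<in> C \<Longrightarrow> a + b \<in> C"
    and C_mult: "a \<in> C \<Longrightarrow> b \<in> C \<Longrightarrow> a * b \<in> C"
    and C_const: "r \<ge> 0 \<Longrightarrow> c r \<in> C"
    and C_arch: "\<exists>r. c r - a \<in> C"
begin

lemma C_zero: "0 \<in> C" and C_one: "1 \<in> C"
  using C_const[of 0] C_const[of 1] by (auto simp: c_0 c_1)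

lemma C_arch_pos: "\<exists>r>0. c r - a \<in> C"
proof -
  obtain r where r: "c r - a \<in> C" using C_arch by blast
  have "c (max r 1 - r) + (c r - a) \<in> C"
    using r by (intro C_add C_const) auto
  then have "c (max r 1) - a \<in> C" by (simp add: c_diff)
  moreover have "max r 1 > 0" by simp
  ultimately show ?thesis by blast
qed

lemma C_lower:
  assumes "f + c r \<in> C" "r \<le> 0"
  shows "f \<in> C"
proof -
  have "f + c r + c (- r) \<in> C" using C_add[OF assms(1) C_const[of "- r"]] assms(2) by simp
  then show ?thesis by (simp add: c_minus)
qed

text \<open>Excluding \<open>- 1\<close> is properness: by \<open>C_arch_pos\<close> every element
  is a difference of two elements of \<open>C\<close>, so a module containing \<open>- 1\<close> is
  everything.\<close>

definition proper_module :: "'a set \<Rightarrow> bool" where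
  "proper_module P \<longleftrightarrow> C \<subseteq> P \<and> (\<forall>a\<in>P. \<forall>b\<in>P. a + b \<in> P) \<and> (\<forall>a\<in>C. \<forall>b\<in>P. a * b \<in> P) \<and> - 1 \<notin> P"

text \<open>If \<open>f * b = 1 + a\<close> with \<open>a, b \<in> C\<close> and \<open>k - b \<in> C\<close>, then
  \<open>k (f + r - 1 / k) = (k - b) (f + r) + a + r b\<close>: every \<open>r\<close> with \<open>f + r \<in> C\<close>
  can be lowered by \<open>1 / k\<close>, until it is negative.\<close>

lemma cone_mem_of_unit:
  assumes "a \<in> C" "b \<in> C" "f * b = 1 + a"
  shows "f \<in> C"
proof -
  obtain k where k: "k > 0" "c k - b \<in> C" using C_arch_pos by blast
  obtain r where r: "r > 0" "f + c r \<in> C"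
    using C_arch_pos[of "- f"] by (auto simp: add.commute)
  have step: "f + c (r - 1 / k) \<in> C" if r: "r \<ge> 0" "f + c r \<in> C" for r
  proof -
    have "c (1 / k) * ((c k - b) * (f + c r) + a + c r * b) \<in> C"
      by (intro C_mult[OF C_const C_add[OF C_add[OF C_mult[OF k(2) r(2)] assms(1)] C_mult[OF C_const assms(2)]]])
        (use k r in auto)
    also have "(c k - b) * (f + c r) + a + c r * b = c k * (f + c r) - 1"
      using assms(3) by (simp add: algebra_simps)
    also have "c (1 / k) * (c k * (f + c r) - 1) = f + c (r - 1 / k)"
      using c_cancel[of k "f + c r"] k
      by (simp add: right_diff_distrib c_diff mult.left_commute)
    finally show ?thesis .
  qed
  \<comment> \<open>The alternative \<open>f \<in> C\<close> absorbs the end of the descent: once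
    \<open>r - real n / k\<close> is negative, \<open>step\<close> no longer applies, but
    \<open>C_lower\<close> does.\<close>
  have "f \<in> C \<or> f + c (r - real n / k) \<in> C" for n
  proof (induction n)
    case 0
    then show ?case using r by simp
  next
    case (Suc n)
    show ?case
    proof (cases "r - real n / k \<ge> 0")
      case True
      have eq: "r - real n / k - 1 / k = r - real (Suc n) / k"
        by (simp add: add_divide_distrib)
      show ?thesis using Suc step[OF True] eq by auto
    next
      case False
      then have "f \<in> C" using Suc C_lower[of f "r - real n / k"] by auto
      then show ?thesis ..
    qed
  qed
  moreover obtain n where n: "real n > r * k" using reals_Archimedean2 by blast
  ultimately consider "f \<in> C" | "f + c (r - real n / k) \<in> C" by blast
  then show ?thesis
  proof cases
    case 2
    then show ?thesis using n k by (intro C_lower[of f "r - real n / k"]) (auto simp: field_simps)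
  qed
qed

text \<open>If \<open>- 1 = a - f * b\<close>, then \<open>f * b = 1 + a\<close>, and
  \<open>cone_mem_of_unit\<close> puts \<open>f\<close> into \<open>C\<close>.\<close>

lemma proper_module_generated:
  assumes "f \<notin> C"
  shows "proper_module {a - f * b | a b. a \<in> C \<and> b \<in> C}" (is "proper_module ?P")
  unfolding proper_module_def
proof (intro conjI ballI)
  show "C \<subseteq> ?P"
  proof
    fix a assume "a \<in> C"
    moreover have "a = a - f * 0" by simp
    ultimately show "a \<in> ?P" using C_zero by blast
  qed
  show "x + y \<in> ?P" if xy: "x \<in> ?P" "y \<in> ?P" for x y
  proof -
    obtain a b a' b' where *: "x = a - f * b" "y = a' - f * b'" "a \<in> C" "b \<in> C" "a' \<in> C" "b' \<in> C"
      using xy by blast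
    have "x + y = (a + a') - f * (b + b')" unfolding *(1,2) by (simp add: algebra_simps)
    then show ?thesis using * C_add by blast
  qed
  show "x * y \<in> ?P" if x: "x \<in> C" and y: "y \<in> ?P" for x y
  proof -
    obtain a b where *: "y = a - f * b" "a \<in> C" "b \<in> C" using y by blast
    have "x * y = x * a - f * (x * b)" unfolding *(1) by (simp add: algebra_simps)
    then show ?thesis using * x C_mult by blast
  qed
  show "- 1 \<notin> ?P"
  proof
    assume "- 1 \<in> ?P"
    then obtain a b where *: "- 1 = a - f * b" "a \<in> C" "b \<in> C" by blast
    from *(1) have "f * b = 1 + a" by (simp add: algebra_simps)
    with * assms cone_mem_of_unit show False by blast
  qed
qed

text \<open>Zorn's lemma: any two elements of the union of a chain lie in a common member, and no
  member contains \<open>- 1\<close>.\<close>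

lemma maximal_proper_module:
  assumes "proper_module Q"
  obtains P where "proper_module P" "Q \<subseteq> P" "\<forall>P'. proper_module P' \<longrightarrow> P \<subseteq> P' \<longrightarrow> P' = P"
proof -
  let ?A = "{P. proper_module P \<and> Q \<subseteq> P}"
  have "\<exists>M\<in>?A. \<forall>X\<in>?A. M \<subseteq> X \<longrightarrow> X = M"
  proof (rule subset_Zorn_nonempty)
    show "?A \<noteq> {}" using assms by blast
    fix \<C> assume ne: "\<C> \<noteq> {}" and ch: "subset.chain ?A \<C>"
    have sub: "proper_module P" "Q \<subseteq> P" if "P \<in> \<C>" for P
      using ch that by (auto simp: subset.chain_def)
    have "proper_module (\<Union>\<C>)"
      unfolding proper_module_def
    proof (intro conjI ballI)
      show "C \<subseteq> \<Union>\<C>" using ne sub unfolding proper_module_def by blast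
      show "a + b \<in> \<Union>\<C>" if a: "a \<in> \<Union>\<C>" and b: "b \<in> \<Union>\<C>" for a b
      proof -
        obtain X Y where XY: "X \<in> \<C>" "Y \<in> \<C>" "a \<in> X" "b \<in> Y" using a b by blast
        then obtain Z where "Z \<in> \<C>" "a \<in> Z" "b \<in> Z"
          using subset.chain_total[OF ch, of X Y] by blast
        then show ?thesis using sub unfolding proper_module_def by blast
      qed
      show "a * b \<in> \<Union>\<C>" if "a \<in> C" "b \<in> \<Union>\<C>" for a b
        using that sub unfolding proper_module_def by blast
      show "- 1 \<notin> \<Union>\<C>" using sub unfolding proper_module_def by blast
    qed
    then show "\<Union>\<C> \<in> ?A" using ne sub by blast
  qed
  then obtain P where P: "P \<in> ?A" "\<forall>X\<in>?A. P \<subseteq> X \<longrightarrow> X = P" by blast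
  show thesis
  proof (rule that)
    show "proper_module P" "Q \<subseteq> P" using P(1) by simp_all
    show "\<forall>P'. proper_module P' \<longrightarrow> P \<subseteq> P' \<longrightarrow> P' = P"
    proof (intro allI impI)
      fix P' assume "proper_module P'" "P \<subseteq> P'"
      moreover from this \<open>Q \<subseteq> P\<close> have "P' \<in> ?A" by simp
      ultimately show "P' = P" using P(2) by simp
    qed
  qed
qed

end

section \<open>Maximal modules and the characters they define\<close>

locale maximal_module = archimedean_cone +
  fixes P
  assumes proper: "proper_module P"
    and maximal: "proper_module P' \<Longrightarrow> P \<subseteq> P' \<Longrightarrow> P' = P"
begin

lemma P_cone: "a \<in> C \<Longrightarrow> a \<in> P"
  and P_add: "a \<in> P \<Longrightarrow> b \<in> P \<Longrightarrow> a + b \<in> P"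
  and P_mult: "a \<in> C \<Longrightarrow> b \<in> P \<Longrightarrow> a * b \<in> P"
  and P_proper: "- 1 \<notin> P"
  using proper unfolding proper_module_def by blast+

text \<open>The set \<open>P + a C\<close> contains \<open>C\<close> and is closed under sums and
  multiplication by \<open>C\<close>. By maximality it is not proper, so it contains
  \<open>- 1\<close>.\<close>

lemma extend:
  assumes "a \<notin> P"
  obtains q b where "q \<in> P" "b \<in> C" "- 1 = q + a * b"
proof -
  let ?Q = "{q + a * b | q b. q \<in> P \<and> b \<in> C}"
  have sub: "P \<subseteq> ?Q"
  proof
    fix x assume "x \<in> P"
    moreover have "x = x + a * 0" by simp
    ultimately show "x \<in> ?Q" using C_zero by blast
  qed
  have "a = 0 + a * 1" by simp
  then have "a \<in> ?Q" using C_one P_cone[OF C_zero] by blast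
  then have "\<not> proper_module ?Q" using maximal sub assms by blast
  moreover have "x + y \<in> ?Q" if xy: "x \<in> ?Q" "y \<in> ?Q" for x y
  proof -
    obtain q b q' b' where *: "x = q + a * b" "y = q' + a * b'" "q \<in> P" "b \<in> C" "q' \<in> P" "b' \<in> C"
      using xy by blast
    have "x + y = (q + q') + a * (b + b')" unfolding *(1,2) by (simp add: algebra_simps)
    then show ?thesis using * C_add P_add by blast
  qed
  moreover have "x * y \<in> ?Q" if x: "x \<in> C" and y: "y \<in> ?Q" for x y
  proof -
    obtain q b where *: "y = q + a * b" "q \<in> P" "b \<in> C" using y by blast
    have "x * y = x * q + a * (x * b)" unfolding *(1) by (simp add: algebra_simps)
    then show ?thesis using * x C_mult P_mult by blast
  qed
  moreover have "C \<subseteq> ?Q" using sub P_cone by blast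
  ultimately have "- 1 \<in> ?Q" unfolding proper_module_def by blast
  then show thesis using that by blast
qed

text \<open>\<open>P \<inter> -P\<close> is an ideal because \<open>C - C\<close> is everything.\<close>

lemma P_total: "a \<in> P \<or> - a \<in> P"
proof (rule ccontr)
  assume "\<not> ?thesis"
  then obtain q b q' b' where
    1: "q \<in> P" "b \<in> C" "- 1 = q + a * b" and 2: "q' \<in> P" "b' \<in> C" "- 1 = q' + (- a) * b'"
    using extend by metis
  have ab: "a * b = - 1 - q" and ab': "a * b' = 1 + q'"
    using arg_cong[OF 1(3), of "\<lambda>x. x - q"] arg_cong[OF 2(3), of "\<lambda>x. q' - x"]
    by (simp_all add: add.commute)
  \<comment> \<open>Eliminating \<open>a\<close> from the two relations writes \<open>- b\<close> as
    a sum of members of \<open>P\<close>.\<close>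
  have "b * (a * b') = b' * (a * b)" by (simp add: algebra_simps)
  then have "b * (1 + q') = b' * (- 1 - q)" by (simp only: ab ab')
  then have "b + (b' + b' * q + b * q') = 0" by (simp add: algebra_simps)
  then have "- b = b' + b' * q + b * q'" by (rule minus_unique)
  then have nb: "- b \<in> P" using 1 2 by (auto intro!: P_add P_mult P_cone[of b'])
  \<comment> \<open>Now \<open>b\<close> and \<open>- b\<close> are both in \<open>P\<close>.
    Multiplying \<open>- b\<close> by \<open>c k + a\<close> or \<open>c k - a\<close> in
    \<open>C\<close> and adding \<open>c k * b\<close> leaves \<open>- (a * b)\<close> or
    \<open>a * b\<close>. The latter gives \<open>- 1 = q + a * b \<in> P\<close>.\<close>
  obtain k where k: "k > 0" "c k - (- a) \<in> C" using C_arch_pos by blast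
  have "(c k - (- a)) * (- b) + c k * b \<in> P"
    using P_add[OF P_mult[OF k(2) nb] P_cone[OF C_mult[OF C_const 1(2)]]] k(1) by simp
  then have "- (a * b) \<in> P" by (simp add: algebra_simps)
  obtain k where k: "k > 0" "c k - a \<in> C" using C_arch_pos by blast
  have "(c k - a) * (- b) + c k * b \<in> P"
    using P_add[OF P_mult[OF k(2) nb] P_cone[OF C_mult[OF C_const 1(2)]]] k(1) by simp
  then have "a * b \<in> P" by (simp add: algebra_simps)
  then have "- 1 \<in> P" using 1 P_add by metis
  then show False using P_proper by simp
qed

text \<open>A negative constant in \<open>P\<close> could be rescaled by a positive constant to
  \<open>- 1\<close>.\<close>

lemma P_const_iff: "c r \<in> P \<longleftrightarrow> r \<ge> 0"
proof
  assume r: "c r \<in> P"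
  show "r \<ge> 0"
  proof (rule ccontr)
    assume "\<not> r \<ge> 0"
    then have "c (1 / (- r)) * c r \<in> P" using r by (intro P_mult C_const) auto
    moreover have "1 / (- r) * r = - 1" using \<open>\<not> r \<ge> 0\<close> by auto
    ultimately show False using P_proper by (simp add: c_mult[symmetric] c_minus c_1)
  qed
qed (use C_const P_cone in blast)

text \<open>The real number cut out by \<open>a\<close> in the constants; it is the value of the character at \<open>a\<close>.\<close>

definition near :: "'a \<Rightarrow> real \<Rightarrow> bool" where
  "near a v \<longleftrightarrow> (\<forall>e>0. a - c (v - e) \<in> P \<and> c (v + e) - a \<in> P)"

text \<open>Adding an upper and a lower bound cancels \<open>a\<close> and leaves a constant in
  \<open>P\<close>, whose sign is known from \<open>P_const_iff\<close>.\<close>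

lemma near_unique:
  assumes "near a v" "near a w"
  shows "v = w"
proof -
  have le: "v \<le> w" if vw: "near a v" "near a w" for v w
  proof (rule field_le_epsilon)
    fix e :: real assume "e > 0"
    then have "e / 2 > 0" by simp
    then have "(c (w + e / 2) - a) + (a - c (v - e / 2)) \<in> P"
      using vw unfolding near_def by (intro P_add) blast+
    moreover have "(c (w + e / 2) - a) + (a - c (v - e / 2)) = c ((w + e / 2) - (v - e / 2))"
      unfolding c_diff by simp
    ultimately have "c ((w + e / 2) - (v - e / 2)) \<in> P" by simp
    then show "v \<le> w + e" unfolding P_const_iff by simp
  qed
  show ?thesis using le assms by (simp add: order_antisym)
qed

text \<open>The value is the supremum of all \<open>r\<close> with \<open>a - c r \<in> P\<close>.
  The archimedean property makes this set nonempty and bounded above; beyond the supremum,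
  \<open>P_total\<close> yields \<open>c r - a \<in> P\<close>.\<close>

lemma near_exists: "\<exists>v. near a v"
proof -
  let ?R = "{r. a - c r \<in> P}"
  obtain k where k: "c k - a \<in> C" using C_arch by blast
  obtain k' where k': "c k' - (- a) \<in> C" using C_arch by blast
  have "- k' \<in> ?R" using k' P_cone by (simp add: c_minus add.commute)
  then have ne: "?R \<noteq> {}" by blast
  have "r \<le> k" if "r \<in> ?R" for r
  proof -
    have "(c k - a) + (a - c r) \<in> P" using that k P_cone P_add by blast
    then have "c (k - r) \<in> P" by (simp add: c_diff)
    then show ?thesis unfolding P_const_iff by simp
  qed
  then have bdd: "bdd_above ?R" by (auto simp: bdd_above_def)
  have "near a (Sup ?R)"
    unfolding near_def
  proof (intro allI impI conjI)
    fix e :: real assume e: "e > 0"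
    then have "Sup ?R - e < Sup ?R" by simp
    then obtain r where r: "a - c r \<in> P" "Sup ?R - e < r"
      using less_cSup_iff[OF ne bdd] by blast
    have "(a - c r) + c (r - (Sup ?R - e)) \<in> P"
      using r by (intro P_add P_cone[OF C_const]) auto
    then show "a - c (Sup ?R - e) \<in> P" by (simp only: c_diff[of r] diff_add_eq_diff_diff_swap[symmetric] diff_add_cancel add_diff_eq)
    have "Sup ?R + e \<notin> ?R" using cSup_upper[OF _ bdd, of "Sup ?R + e"] e by auto
    then show "c (Sup ?R + e) - a \<in> P" using P_total[of "a - c (Sup ?R + e)"] by auto
  qed
  then show ?thesis ..
qed

lemma near_add:
  assumes "near a v" "near b w"
  shows "near (a + b) (v + w)"
  unfolding near_def
proof (intro allI impI)
  fix e :: real assume "e > 0"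
  then have *: "a - c (v - e / 2) \<in> P" "c (v + e / 2) - a \<in> P"
    "b - c (w - e / 2) \<in> P" "c (w + e / 2) - b \<in> P"
    using assms unfolding near_def by (auto simp: half_gt_zero)
  have "a + b - c (v + w - e) = (a - c (v - e / 2)) + (b - c (w - e / 2))"
    "c (v + w + e) - (a + b) = (c (v + e / 2) - a) + (c (w + e / 2) - b)"
  proof -
    have "v + w - e = (v - e / 2) + (w - e / 2)" "v + w + e = (v + e / 2) + (w + e / 2)" by simp_all
    then have "c (v + w - e) = c (v - e / 2) + c (w - e / 2)" "c (v + w + e) = c (v + e / 2) + c (w + e / 2)"
      by (simp_all only: c_add)
    then show "a + b - c (v + w - e) = (a - c (v - e / 2)) + (b - c (w - e / 2))"
      "c (v + w + e) - (a + b) = (c (v + e / 2) - a) + (c (w + e / 2) - b)"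
      by (simp_all only: algebra_simps)
  qed
  then show "a + b - c (v + w - e) \<in> P \<and> c (v + w + e) - (a + b) \<in> P"
    using * P_add by metis
qed

lemma near_uminus: "near a v \<Longrightarrow> near (- a) (- v)"
  unfolding near_def by (auto simp: c_diff c_add c_minus algebra_simps)

lemma near_const: "near (c r) r"
  unfolding near_def by (auto simp: c_diff c_add P_const_iff)

text \<open>\<open>P\<close> is a module over \<open>C\<close> only, so the factor \<open>b\<close>
  is first taken in the cone. With \<open>d = e / k\<close>, the sum
  \<open>b * (a + c d) + c d * (c k - b)\<close> equals \<open>b * a + c e\<close>; the other bound
  is alike.\<close>

lemma near_mult_cone:
  assumes b: "b \<in> C" and a: "near a 0"
  shows "near (b * a) 0"
  unfolding near_def
proof (intro allI impI)
  fix e :: real assume "e > 0"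
  obtain k where k: "k > 0" "c k - b \<in> C" using C_arch_pos by blast
  define d where "d = e / k"
  have d: "d > 0" "d * k = e" using k \<open>e > 0\<close> by (auto simp: d_def)
  have ad: "a + c d \<in> P" "c d - a \<in> P" using a d by (auto simp: near_def c_minus)
  have e: "c e = c d * c k" using d by (simp add: c_mult[symmetric])
  have "b * (a + c d) + c d * (c k - b) \<in> P" "b * (c d - a) + c d * (c k - b) \<in> P"
    using ad b d k by (intro P_add[OF P_mult P_cone[OF C_mult]] C_const; simp)+
  then show "b * a - c (0 - e) \<in> P \<and> c (0 + e) - b * a \<in> P"
    by (simp add: e c_minus algebra_simps)
qed

text \<open>Writing \<open>b = c k - (c k - b)\<close> as a difference of cone elements extends
  \<open>near_mult_cone\<close> to every \<open>b\<close>. It is applied to \<open>a - c v\<close>,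
  which is near 0, and \<open>c v * b\<close> is added back; \<open>scale\<close> allows
  \<open>v\<close> of either sign.\<close>

lemma near_mult:
  assumes "near a v" "near b w"
  shows "near (b * a) (w * v)"
proof -
  have a0: "near (a - c v) 0" using near_add[OF assms(1) near_const[of "- v"]] by (simp add: c_minus)
  obtain k where k: "k > 0" "c k - b \<in> C" using C_arch_pos by blast
  have "near (c k * (a - c v)) 0" "near ((c k - b) * (a - c v)) 0"
    using near_mult_cone a0 k C_const by auto
  then have "near (c k * (a - c v) + - ((c k - b) * (a - c v))) (0 + - 0)"
    by (intro near_add near_uminus)
  then have 1: "near (b * (a - c v)) 0" by (simp add: algebra_simps)
  have scale: "near (c r * b) (r * w)" for r
  proof -
    have b0: "near (b - c w) 0" using near_add[OF assms(2) near_const[of "- w"]] by (simp add: c_minus)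
    have "near (c r * (b - c w)) 0"
    proof (cases "r \<ge> 0")
      case True then show ?thesis using near_mult_cone b0 C_const by blast
    next
      case False
      then have "near (c (- r) * (b - c w)) 0" by (intro near_mult_cone b0 C_const) auto
      from near_uminus[OF this] show ?thesis by (simp add: c_minus)
    qed
    from near_add[OF this near_const[of "r * w"]] show ?thesis by (simp add: algebra_simps c_mult)
  qed
  from near_add[OF 1 scale[of v]] show ?thesis by (simp add: algebra_simps)
qed

text \<open>\<open>L\<close> picks the value of each cut. If \<open>a \<in> P\<close> had
  \<open>L a < 0\<close>, the upper bound of the cut at half that distance would put the negative
  constant \<open>L a / 2\<close> into \<open>P\<close>.\<close>

lemma character_exists:
  obtains L where "character L" "\<And>a. a \<in> P \<Longrightarrow> L a \<ge> 0"
proof -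
  obtain L where L: "near a (L a)" for a using near_exists by metis
  have "character L"
    unfolding character_def using near_unique L near_add near_mult near_const by metis
  moreover have "L a \<ge> 0" if "a \<in> P" for a
  proof (rule ccontr)
    assume "\<not> L a \<ge> 0"
    then have "- L a / 2 > 0" by simp
    then have "c (L a + (- L a / 2)) - a \<in> P" using L[of a] unfolding near_def by blast
    with that have "a + (c (L a + (- L a / 2)) - a) \<in> P" by (rule P_add)
    then have "c (L a + (- L a / 2)) \<in> P" by simp
    then show False using \<open>\<not> L a \<ge> 0\<close> unfolding P_const_iff by simp
  qed
  ultimately show thesis using that by blast
qed

end

section \<open>Separation by a character\<close>

context archimedean_cone
begin

text \<open>The maximal module is taken above \<open>C - f C\<close>, which contains
  \<open>- f\<close>; hence the weak inequality \<open>L f \<le> 0\<close>.\<close>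

theorem separating_character:
  assumes "f \<notin> C"
  obtains L where "character L" "\<And>a. a \<in> C \<Longrightarrow> L a \<ge> 0" "L f \<le> 0"
proof -
  obtain P where P: "proper_module P" "{a - f * b | a b. a \<in> C \<and> b \<in> C} \<subseteq> P"
    "\<forall>P'. proper_module P' \<longrightarrow> P \<subseteq> P' \<longrightarrow> P' = P"
    by (rule maximal_proper_module[OF proper_module_generated[OF assms]])
  interpret maximal_module c C P
    by unfold_locales (use P(1,3) in blast)+
  obtain L where L: "character L" "\<And>a. a \<in> P \<Longrightarrow> L a \<ge> 0" using character_exists by blast
  have "0 - f * 1 \<in> P" using P(2) C_zero C_one by blast
  then have "L (- f) \<ge> 0" using L by simp
  moreover have "L (f + - f) = L f + L (- f)" "L (c 0) = 0"
    using L(1) unfolding character_def by blast+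
  ultimately have "L f \<le> 0" by (simp add: c_0)
  then show thesis using L P_cone that by blast
qed

end


section \<open>Sums of powers\<close>

lemma sums_of_powersI: "(\<Sum>i<(k::nat). g i ^ m) \<in> sums_of_powers m"
  unfolding sums_of_powers_def by blast

lemma sums_of_powersE:
  assumes "a \<in> sums_of_powers m"
  obtains k :: nat and h where "a = (\<Sum>i<k. h i ^ m)"
  using assms unfolding sums_of_powers_def by (elim CollectE exE conjE) (rule that)

lemma sums_of_powers_zero: "0 \<in> sums_of_powers m"
  using sums_of_powersI[of _ m 0] by simp

lemma sums_of_powers_power: "g ^ m \<in> sums_of_powers m"
  using sums_of_powersI[of "\<lambda>_. g" m 1] by simp

lemma sums_of_powers_add_power:
  assumes "a \<in> sums_of_powers m"
  shows "a + g ^ m \<in> sums_of_powers m"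
proof -
  obtain k h where "a = (\<Sum>i<(k::nat). h i ^ m)" using assms by (rule sums_of_powersE)
  then have "a + g ^ m = (\<Sum>i<Suc k. (h(k := g)) i ^ m)" by simp
  then show ?thesis using sums_of_powersI by metis
qed

lemma sums_of_powers_induct [consumes 1, case_names zero add]:
  assumes "a \<in> sums_of_powers m" "Q 0"
    and add: "\<And>a g. a \<in> sums_of_powers m \<Longrightarrow> Q a \<Longrightarrow> Q (a + g ^ m)"
  shows "Q a"
proof -
  obtain k h where a: "a = (\<Sum>i<(k::nat). h i ^ m)" using assms(1) by (rule sums_of_powersE)
  have "Q (\<Sum>i<k. h i ^ m)"
  proof (induction k)
    case (Suc k)
    with add[OF sums_of_powersI] show ?case by simp
  qed (use assms(2) in simp)
  then show ?thesis by (simp add: a)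
qed

lemma sums_of_powers_add:
  assumes "a \<in> sums_of_powers m" "b \<in> sums_of_powers m"
  shows "a + b \<in> sums_of_powers m"
  using assms(2)
  by (induction rule: sums_of_powers_induct)
    (use assms(1) in \<open>auto simp: add.assoc[symmetric] intro: sums_of_powers_add_power\<close>)

text \<open>Two nested inductions reduce to single powers, where commutativity gives
  \<open>h ^ m * g ^ m = (h * g) ^ m\<close>.\<close>

lemma sums_of_powers_mult:
  assumes "a \<in> sums_of_powers m" "b \<in> sums_of_powers m"
  shows "a * b \<in> sums_of_powers m"
  using assms(2)
proof (induction rule: sums_of_powers_induct)
  case zero
  then show ?case by (simp add: sums_of_powers_zero)
next
  case (add b g)
  have "a * g ^ m \<in> sums_of_powers m"
    using assms(1)
  proof (induction rule: sums_of_powers_induct)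
    case zero
    then show ?case by (simp add: sums_of_powers_zero)
  next
    case (add a h)
    then have "a * g ^ m + (h * g) ^ m \<in> sums_of_powers m" by (intro sums_of_powers_add_power)
    then show ?case by (simp add: distrib_right power_mult_distrib)
  qed
  with add show ?case by (simp add: distrib_left sums_of_powers_add)
qed

section \<open>Closures in a seminormed algebra\<close>

locale seminormed_algebra = real_scalars +
  fixes p :: "'a \<Rightarrow> real"
  assumes p_nonneg: "p a \<ge> 0"
    and p_add: "p (a + b) \<le> p a + p b"
    and p_mult: "p (a * b) \<le> p a * p b"
    and p_scale: "p (c r * a) = \<bar>r\<bar> * p a"
begin

lemma c_power: "c (r ^ n) = c r ^ n"
  by (induction n) (simp_all add: c_1 c_mult)

lemma c_of_nat: "c (real n) = of_nat n"
  by (induction n) (simp_all add: c_0 c_1 c_add)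

lemma p_zero: "p 0 = 0"
  using p_scale[of 0 0] by simp

lemma p_minus: "p (- a) = p a"
  using p_scale[of "- 1" a] by (simp add: c_minus c_1)

lemma p_diff: "p (a - b) \<le> p a + p b"
  using p_add[of a "- b"] by (simp add: p_minus)

lemma p_diff_commute: "p (a - b) = p (b - a)"
  using p_minus[of "a - b"] by simp

text \<open>Exponent 0 is excluded because \<open>p 1\<close> may exceed 1.\<close>

lemma p_power: "n \<ge> 1 \<Longrightarrow> p (a ^ n) \<le> p a ^ n"
proof (induction n rule: dec_induct)
  case (step n)
  have "p (a ^ Suc n) \<le> p a * p (a ^ n)" using p_mult by simp
  also have "\<dots> \<le> p a * p a ^ n" by (intro mult_left_mono step.IH p_nonneg)
  finally show ?case by simp
qed simp

definition seminorm_closure :: "'a set \<Rightarrow> 'a set" where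
  "seminorm_closure S = {f. \<forall>e>0. \<exists>g\<in>S. p (g - f) < e}"

text \<open>Second-order Taylor bound. The remainder for \<open>Suc m\<close> is
  \<open>R * (1 - b) + m * b * b\<close>, so for \<open>p b \<le> 1\<close> the constant grows from
  \<open>\<kappa>\<close> to \<open>2 * \<kappa> + m\<close>. Keeping
  \<open>\<kappa> \<ge> 1\<close> allows division by it later.\<close>

lemma power_remainder:
  "\<exists>\<kappa>\<ge>1. \<forall>b. p b \<le> 1 \<longrightarrow> p ((1 - b) ^ m - 1 + of_nat m * b) \<le> \<kappa> * (p b)\<^sup>2"
proof (induction m)
  case 0
  then show ?case by (intro exI[of _ 1]) (simp add: p_zero)
next
  case (Suc m)
  then obtain \<kappa> where \<kappa>: "\<kappa> \<ge> 1"
    "\<And>b. p b \<le> 1 \<Longrightarrow> p ((1 - b) ^ m - 1 + of_nat m * b) \<le> \<kappa> * (p b)\<^sup>2" by blast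
  have "p ((1 - b) ^ Suc m - 1 + of_nat (Suc m) * b) \<le> (2 * \<kappa> + real m) * (p b)\<^sup>2" if b: "p b \<le> 1" for b
  proof -
    define R where "R = (1 - b) ^ m - 1 + of_nat m * b"
    have R: "p R \<le> \<kappa> * (p b)\<^sup>2" unfolding R_def using \<kappa>(2) b .
    have "(1 - b) ^ Suc m - 1 + of_nat (Suc m) * b = R - R * b + c (real m) * (b * b)"
      unfolding R_def by (simp add: c_of_nat algebra_simps)
    also have "p \<dots> \<le> p R + p R * p b + real m * (p b)\<^sup>2"
    proof -
      have "p (R - R * b + c (real m) * (b * b)) \<le> (p R + p (R * b)) + p (c (real m) * (b * b))"
        using p_add p_diff by (meson add_mono order_refl order_trans)
      also have "p (c (real m) * (b * b)) \<le> real m * (p b)\<^sup>2"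
        by (simp add: p_scale power2_eq_square p_mult mult_left_mono)
      finally show ?thesis using p_mult[of R b] by linarith
    qed
    also have "p R * p b \<le> p R" using b p_nonneg by (simp add: mult_left_le)
    finally show ?thesis using R by (simp add: algebra_simps)
  qed
  moreover have "2 * \<kappa> + real m \<ge> 1" using \<kappa> by simp
  ultimately show ?case by blast
qed

section \<open>The closed cone generated by even powers\<close>

context
  fixes m :: nat
  assumes m: "m \<ge> 1" and even: "even m"
begin

lemma c_sums_of_powers:
  assumes "r \<ge> 0"
  shows "c r \<in> sums_of_powers m"
proof -
  have "c (root m r) ^ m = c r" using m assms by (simp add: c_power[symmetric])
  then show ?thesis using sums_of_powers_power by metis
qed

text \<open>The scaling \<open>b = a / (2 * \<kappa> * \<delta>)\<close> gives
  \<open>p b \<le> 1 / (2 * \<kappa>)\<close>, and \<open>K = 2 * \<kappa> / m\<close> gives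
  \<open>K * \<delta> * m * b = a\<close>. So \<open>K * \<delta> * (1 - b) ^ m\<close> has the
  right terms up to first order, and the remainder costs at most
  \<open>\<delta> / (2 * m)\<close>.\<close>

lemma approx_step:
  "\<exists>K>0. \<forall>\<delta>>0. \<forall>a. p a \<le> \<delta> \<longrightarrow> (\<exists>s\<in>sums_of_powers m. p (c (K * \<delta>) - a - s) \<le> \<delta> / 2)"
proof -
  obtain \<kappa> where \<kappa>: "\<kappa> \<ge> 1"
    "\<And>b. p b \<le> 1 \<Longrightarrow> p ((1 - b) ^ m - 1 + of_nat m * b) \<le> \<kappa> * (p b)\<^sup>2"
    using power_remainder by blast
  define K where "K = 2 * \<kappa> / m"
  have K: "K > 0" using \<kappa> m by (simp add: K_def)
  have "\<exists>s\<in>sums_of_powers m. p (c (K * \<delta>) - a - s) \<le> \<delta> / 2" if \<delta>: "\<delta> > 0" and a: "p a \<le> \<delta>" for \<delta> a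
  proof -
    define b where "b = c (1 / (2 * \<kappa> * \<delta>)) * a"
    have pb: "p b \<le> 1 / (2 * \<kappa>)"
    proof -
      have "p b = p a / (2 * \<kappa> * \<delta>)" using \<delta> \<kappa>(1) by (simp add: b_def p_scale)
      also have "\<dots> \<le> \<delta> / (2 * \<kappa> * \<delta>)" using a \<delta> \<kappa>(1) by (intro divide_right_mono) auto
      finally show ?thesis using \<delta> by simp
    qed
    also have "\<dots> \<le> 1" using \<kappa>(1) by simp
    finally have pb1: "p b \<le> 1" .
    define R where "R = (1 - b) ^ m - 1 + of_nat m * b"
    have R: "p R \<le> \<kappa> * (p b)\<^sup>2" unfolding R_def using \<kappa>(2) pb1 .
    have "c (K * \<delta>) * (of_nat m * b) = a"
    proof -
      have "c (K * \<delta>) * (of_nat m * b) = c (K * \<delta> * real m * (1 / (2 * \<kappa> * \<delta>))) * a"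
        by (simp only: b_def c_mult c_of_nat mult.assoc)
      also have "K * \<delta> * real m * (1 / (2 * \<kappa> * \<delta>)) = 1"
        using m \<kappa>(1) \<delta> by (simp add: K_def)
      finally show ?thesis by (simp add: c_1)
    qed
    then have "c (K * \<delta>) - a - c (K * \<delta>) * (1 - b) ^ m = - (c (K * \<delta>) * R)"
      unfolding R_def by (simp add: algebra_simps)
    then have "p (c (K * \<delta>) - a - c (K * \<delta>) * (1 - b) ^ m) = K * \<delta> * p R"
      using K \<delta> by (simp add: p_minus p_scale)
    also have "\<dots> \<le> K * \<delta> * (\<kappa> * (1 / (2 * \<kappa>))\<^sup>2)"
    proof -
      have "(p b)\<^sup>2 \<le> (1 / (2 * \<kappa>))\<^sup>2" using pb p_nonneg by (intro power_mono) auto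
      then have "p R \<le> \<kappa> * (1 / (2 * \<kappa>))\<^sup>2"
        using R \<kappa>(1) by (meson order_trans mult_left_mono zero_le_one)
      then show ?thesis using K \<delta> by (intro mult_left_mono) auto
    qed
    also have "\<dots> = \<delta> / (2 * real m)"
      using \<kappa>(1) by (simp add: K_def power2_eq_square)
    also have "\<dots> \<le> \<delta> / 2" using m \<delta> by (simp add: field_simps)
    finally show ?thesis
      using K \<delta> by (intro bexI[OF _ sums_of_powers_mult[OF c_sums_of_powers sums_of_powers_power]]) auto
  qed
  with K show ?thesis by blast
qed

text \<open>\<open>approx_step\<close> is iterated on the negated error, which halves each time; the
  constants form a geometric series with sum \<open>2 * K * \<delta>\<close>. That \<open>K\<close>
  is independent of \<open>a\<close> is what \<open>positive_character_bound\<close> relies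
  on.\<close>

lemma cone_dominates_seminorm:
  "\<exists>K>0. \<forall>\<delta>>0. \<forall>a. p a \<le> \<delta> \<longrightarrow> c (K * \<delta>) - a \<in> seminorm_closure (sums_of_powers m)"
proof -
  obtain K where K: "K > 0"
    "\<And>\<delta> a. \<delta> > 0 \<Longrightarrow> p a \<le> \<delta> \<Longrightarrow> \<exists>s\<in>sums_of_powers m. p (c (K * \<delta>) - a - s) \<le> \<delta> / 2"
    using approx_step by blast
  \<comment> \<open>At \<open>n = 0\<close> the witness is the whole constant, with error
    \<open>- a\<close>. In the step one round uses \<open>K * \<delta>\<close>, and the induction
    hypothesis at \<open>\<delta> / 2\<close> uses the other half.\<close>
  have approx: "\<exists>s\<in>sums_of_powers m. p (c (2 * K * \<delta>) - a - s) \<le> \<delta> / 2 ^ n"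
    if "\<delta> > 0" "p a \<le> \<delta>" for \<delta> a n
    using that
  proof (induction n arbitrary: \<delta> a)
    case 0
    then show ?case
      using K by (intro bexI[OF _ c_sums_of_powers[of "2 * K * \<delta>"]]) (auto simp: p_minus)
  next
    case (Suc n)
    obtain s where s: "s \<in> sums_of_powers m" "p (c (K * \<delta>) - a - s) \<le> \<delta> / 2"
      using K(2) Suc.prems by blast
    have "\<delta> / 2 > 0" using Suc.prems by simp
    moreover have "p (- (c (K * \<delta>) - a - s)) \<le> \<delta> / 2" using s(2) by (simp only: p_minus)
    ultimately obtain t where t: "t \<in> sums_of_powers m"
      "p (c (2 * K * (\<delta> / 2)) - (- (c (K * \<delta>) - a - s)) - t) \<le> \<delta> / 2 / 2 ^ n"
      using Suc.IH by blast
    have "2 * K * \<delta> = K * \<delta> + K * \<delta>" by simp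
    then have "c (2 * K * \<delta>) = c (K * \<delta>) + c (K * \<delta>)" by (simp only: c_add)
    then have eq: "c (2 * K * (\<delta> / 2)) - (- (c (K * \<delta>) - a - s)) - t = c (2 * K * \<delta>) - a - (s + t)"
      by (simp add: algebra_simps)
    have "p (c (2 * K * \<delta>) - a - (s + t)) \<le> \<delta> / 2 ^ Suc n"
      using t(2) unfolding eq by simp
    then show ?case using sums_of_powers_add s(1) t(1) by blast
  qed
  have "c (2 * K * \<delta>) - a \<in> seminorm_closure (sums_of_powers m)" if "\<delta> > 0" "p a \<le> \<delta>" for \<delta> a
    unfolding seminorm_closure_def
  proof (intro CollectI allI impI)
    fix e :: real assume e: "e > 0"
    obtain n where "\<delta> / e < 2 ^ n" using real_arch_pow[of 2] by auto
    then have "\<delta> / 2 ^ n < e" using e by (simp add: field_simps)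
    moreover obtain s where "s \<in> sums_of_powers m" "p (c (2 * K * \<delta>) - a - s) \<le> \<delta> / 2 ^ n"
      using approx \<open>\<delta> > 0\<close> \<open>p a \<le> \<delta>\<close> by blast
    ultimately show "\<exists>s\<in>sums_of_powers m. p (s - (c (2 * K * \<delta>) - a)) < e"
      by (metis p_diff_commute le_less_trans)
  qed
  then show ?thesis using K(1) by (intro exI[of _ "2 * K"]) auto
qed

lemma closure_supset: "S \<subseteq> seminorm_closure S"
  unfolding seminorm_closure_def by (force simp: p_zero)

lemma archimedean_closure: "archimedean_cone c (seminorm_closure (sums_of_powers m))"
proof
  let ?S = "sums_of_powers m"
  show "a + b \<in> seminorm_closure ?S" if ab: "a \<in> seminorm_closure ?S" "b \<in> seminorm_closure ?S" for a b
    unfolding seminorm_closure_def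
  proof (intro CollectI allI impI)
    fix e :: real assume "e > 0"
    then have "e / 2 > 0" by simp
    then obtain s t where st: "s \<in> ?S" "t \<in> ?S" "p (s - a) < e / 2" "p (t - b) < e / 2"
      using ab unfolding seminorm_closure_def by blast
    have "p (s + t - (a + b)) \<le> p (s - a) + p (t - b)"
      using p_add[of "s - a" "t - b"] by (simp add: algebra_simps)
    then show "\<exists>g\<in>?S. p (g - (a + b)) < e" using st sums_of_powers_add by (intro bexI[of _ "s + t"]) auto
  qed
  show "a * b \<in> seminorm_closure ?S" if ab: "a \<in> seminorm_closure ?S" "b \<in> seminorm_closure ?S" for a b
    unfolding seminorm_closure_def
  proof (intro CollectI allI impI)
    fix e :: real assume e: "e > 0"
    \<comment> \<open>The three error terms below are at most \<open>d * (1 + p a + p b)\<close>,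
      the 1 coming from \<open>d \<le> 1\<close>; the summand 2 makes the final inequality
      strict.\<close>
    define d where "d = min 1 (e / (p a + p b + 2))"
    have pos: "p a + p b + 2 > 0" using p_nonneg[of a] p_nonneg[of b] by simp
    have d: "d > 0" "d \<le> 1" "d * (p a + p b + 2) \<le> e"
      using e pos mult_right_mono[OF min.cobounded2[of 1 "e / (p a + p b + 2)"], of "p a + p b + 2"]
      by (auto simp: d_def)
    obtain s t where st: "s \<in> ?S" "t \<in> ?S" "p (s - a) < d" "p (t - b) < d"
      using ab d unfolding seminorm_closure_def by blast
    have "s * t - a * b = (s - a) * (t - b) + (s - a) * b + a * (t - b)" by (simp add: algebra_simps)
    then have "p (s * t - a * b) \<le> p ((s - a) * (t - b)) + p ((s - a) * b) + p (a * (t - b))"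
      by (metis p_add add_right_mono order_trans)
    also have "\<dots> \<le> p (s - a) * p (t - b) + p (s - a) * p b + p a * p (t - b)"
      by (intro add_mono p_mult)
    also have "\<dots> \<le> d * 1 + d * p b + p a * d"
      using st d p_nonneg by (intro add_mono mult_mono) (auto intro: less_imp_le order_trans)
    also have "\<dots> < d * (p a + p b + 2)" using d by (simp add: algebra_simps)
    finally show "\<exists>g\<in>?S. p (g - a * b) < e" using st d sums_of_powers_mult by (intro bexI[of _ "s * t"]) auto
  qed
  show "c r \<in> seminorm_closure ?S" if "r \<ge> 0" for r
    using that closure_supset c_sums_of_powers by blast
  show "\<exists>r. c r - a \<in> seminorm_closure ?S" for a
  proof -
    obtain K where K: "\<And>\<delta> a. \<delta> > 0 \<Longrightarrow> p a \<le> \<delta> \<Longrightarrow> c (K * \<delta>) - a \<in> seminorm_closure ?S"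
      using cone_dominates_seminorm by blast
    have "c (K * (p a + 1)) - a \<in> seminorm_closure ?S"
      using p_nonneg[of a] by (intro K) simp_all
    then show ?thesis ..
  qed
qed

text \<open>Positivity on the closure gives \<open>L a \<le> K p a\<close>; multiplicativity turns this into
  \<open>\<bar>L a\<bar> ^ n \<le> K (p a) ^ n\<close>, so that the constant \<open>K\<close> disappears.\<close>

lemma positive_character_bound:
  assumes L: "character L" "\<And>a. a \<in> seminorm_closure (sums_of_powers m) \<Longrightarrow> L a \<ge> 0"
  shows "\<bar>L a\<bar> \<le> p a"
proof (rule dense_ge)
  \<comment> \<open>Any \<open>t > p a\<close> is positive even if \<open>p a = 0\<close>, so powers
    of \<open>t\<close> can be divided by.\<close>
  fix t assume t: "p a < t"
  then have t0: "t > 0" using p_nonneg[of a] by simp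
  have Ladd: "L (x + y) = L x + L y" and Lmult: "L (x * y) = L x * L y" and Lc: "L (c r) = r" for x y r
    using L(1) unfolding character_def by auto
  have Ldiff: "L (x - y) = L x - L y" for x y using Ladd[of "x - y" y] by simp
  have Lpow: "L (a ^ n) = L a ^ n" for n
    by (induction n) (use Lc[of 1] in \<open>simp_all add: Lmult c_1\<close>)
  obtain K where K: "K > 0"
    "\<And>\<delta> a. \<delta> > 0 \<Longrightarrow> p a \<le> \<delta> \<Longrightarrow> c (K * \<delta>) - a \<in> seminorm_closure (sums_of_powers m)"
    using cone_dominates_seminorm by blast
  have bound: "\<bar>L x\<bar> \<le> K * \<delta>" if "\<delta> > 0" "p x \<le> \<delta>" for x \<delta>
  proof -
    have "L x \<le> K * \<delta>" using L(2)[OF K(2)[OF that]] by (simp add: Ldiff Lc)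
    moreover have "L (c (K * \<delta>) - (- x)) \<ge> 0" using that by (intro L(2) K(2)) (simp_all add: p_minus)
    then have "- L x \<le> K * \<delta>" by (simp add: Ladd Lc)
    ultimately show ?thesis by simp
  qed
  have pow: "(\<bar>L a\<bar> / t) ^ n \<le> K" if "n \<ge> 1" for n
  proof -
    have "p (a ^ n) \<le> t ^ n"
      using p_power[OF that, of a] t p_nonneg by (meson less_imp_le order_trans power_mono)
    then have "\<bar>L a\<bar> ^ n \<le> K * t ^ n" using bound[of "t ^ n" "a ^ n"] t0 by (simp add: Lpow power_abs)
    then show ?thesis using t0 by (simp add: power_divide field_simps)
  qed
  show "\<bar>L a\<bar> \<le> t"
  proof (rule ccontr)
    assume "\<not> \<bar>L a\<bar> \<le> t"
    then have q: "\<bar>L a\<bar> / t > 1" using t0 by simp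
    then obtain n where n: "K < (\<bar>L a\<bar> / t) ^ n" using real_arch_pow by blast
    \<comment> \<open>\<open>pow\<close> needs a positive exponent, while \<open>n\<close> may be
      0.\<close>
    also have "\<dots> \<le> (\<bar>L a\<bar> / t) ^ Suc n" using q by (intro power_increasing) auto
    finally show False using pow[of "Suc n"] by simp
  qed
qed

text \<open>Bounded characters are continuous and nonnegative on even powers, which gives one
  inclusion. Conversely, a character separating \<open>f\<close> from the closure is itself bounded
  by \<open>p\<close>.\<close>

theorem closure_sums_of_powers:
  "seminorm_closure (sums_of_powers m) = {f. \<forall>L. character L \<and> (\<forall>a. \<bar>L a\<bar> \<le> p a) \<longrightarrow> L f \<ge> 0}"
proof (intro set_eqI iffI CollectI allI impI)
  fix f L
  assume f: "f \<in> seminorm_closure (sums_of_powers m)" and L: "character L \<and> (\<forall>a. \<bar>L a\<bar> \<le> p a)"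
  have Ladd: "L (x + y) = L x + L y" and Lmult: "L (x * y) = L x * L y" and Lc: "L (c r) = r" for x y r
    using L unfolding character_def by auto
  have Ldiff: "L (x - y) = L x - L y" for x y using Ladd[of "x - y" y] by simp
  have Lpow: "L (x ^ n) = L x ^ n" for n x
    by (induction n) (use Lc[of 1] in \<open>simp_all add: Lmult c_1\<close>)
  have pos: "L s \<ge> 0" if "s \<in> sums_of_powers m" for s
    using that
    by (induction rule: sums_of_powers_induct)
      (use Lc[of 0] even in \<open>simp_all add: Ladd Lpow c_0 zero_le_even_power\<close>)
  show "L f \<ge> 0"
  proof (rule field_le_epsilon)
    fix e :: real assume "e > 0"
    then obtain s where s: "s \<in> sums_of_powers m" "p (s - f) < e"
      using f unfolding seminorm_closure_def by blast
    have "\<bar>L s - L f\<bar> < e" using L s(2) by (metis Ldiff le_less_trans)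
    then show "0 \<le> L f + e" using pos[OF s(1)] by simp
  qed
next
  fix f
  assume f: "f \<in> {f. \<forall>L. character L \<and> (\<forall>a. \<bar>L a\<bar> \<le> p a) \<longrightarrow> L f \<ge> 0}"
  let ?C = "seminorm_closure (sums_of_powers m)"
  interpret archimedean_cone c ?C by (rule archimedean_closure)
  \<comment> \<open>Separation gives only a weak inequality; the shift turns it into
    \<open>L f \<le> - e < 0\<close>.\<close>
  have shift: "f + c e \<in> ?C" if "e > 0" for e
  proof (rule ccontr)
    assume "f + c e \<notin> ?C"
    then obtain L where L: "character L" "\<And>a. a \<in> ?C \<Longrightarrow> L a \<ge> 0" "L (f + c e) \<le> 0"
      using separating_character by blast
    have "L f \<ge> 0" using f L(1) positive_character_bound[OF L(1,2)] by blast
    moreover have "L (f + c e) = L f + e" using L(1) unfolding character_def by simp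
    ultimately show False using L(3) that by simp
  qed
  show "f \<in> ?C"
    unfolding seminorm_closure_def
  proof (intro CollectI allI impI)
    fix e :: real assume e: "e > 0"
    \<comment> \<open>Removing the shift costs \<open>d * p 1 \<le> e / 2\<close>; the added 1
      guards against \<open>p 1 = 0\<close>.\<close>
    define d where "d = e / (2 * (p 1 + 1))"
    have p1: "p 1 + 1 > 0" using p_nonneg[of 1] by simp
    have d: "d > 0" "d * p 1 \<le> e / 2" using e p1 by (auto simp: d_def field_simps)
    obtain s where s: "s \<in> sums_of_powers m" "p (s - (f + c d)) < e / 2"
      using shift[OF d(1)] half_gt_zero[OF e] unfolding seminorm_closure_def by blast
    have "p (s - f) \<le> p (s - (f + c d)) + p (c d * 1)"
      using p_add[of "s - (f + c d)" "c d * 1"] by simp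
    also have "\<dots> < e" using s(2) d p_scale[of d 1] by simp
    finally show "\<exists>g\<in>sums_of_powers m. p (g - f) < e" using s(1) by blast
  qed
qed

end

end

section \<open>Polynomials\<close>

lemma phi_seminorm_superset:
  assumes "finite A" "Poly_Mapping.keys f \<subseteq> A"
  shows "phi_seminorm \<phi> f = (\<Sum>s\<in>A. \<bar>Poly_Mapping.lookup f s\<bar> * \<phi> s)"
  unfolding phi_seminorm_def
  by (intro sum.mono_neutral_left) (use assms in \<open>auto simp: in_keys_iff\<close>)

lemma poly_eval_superset:
  assumes "finite A" "Poly_Mapping.keys f \<subseteq> A"
  shows "poly_eval f x = (\<Sum>s\<in>A. Poly_Mapping.lookup f s * monomial_eval x s)"
  unfolding poly_eval_def
  by (intro sum.mono_neutral_left) (use assms in \<open>auto simp: in_keys_iff\<close>)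

lemma phi_seminorm_single: "phi_seminorm \<phi> (Poly_Mapping.single s r) = \<bar>r\<bar> * \<phi> s"
  by (subst phi_seminorm_superset[of "{s}"]) auto

lemma poly_eval_single: "poly_eval (Poly_Mapping.single s r) x = r * monomial_eval x s"
  by (subst poly_eval_superset[of "{s}"]) auto

lemma poly_eval_add: "poly_eval (f + g) x = poly_eval f x + poly_eval g x"
proof -
  let ?A = "Poly_Mapping.keys f \<union> Poly_Mapping.keys g"
  have "poly_eval (f + g) x = (\<Sum>s\<in>?A. Poly_Mapping.lookup (f + g) s * monomial_eval x s)"
    by (intro poly_eval_superset keys_add) auto
  also have "\<dots> = (\<Sum>s\<in>?A. Poly_Mapping.lookup f s * monomial_eval x s)
      + (\<Sum>s\<in>?A. Poly_Mapping.lookup g s * monomial_eval x s)"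
    by (simp add: lookup_add distrib_right sum.distrib)
  finally show ?thesis
    by (simp add: poly_eval_superset[of ?A f] poly_eval_superset[of ?A g])
qed

lemma phi_seminorm_add:
  assumes "\<And>s. \<phi> s \<ge> 0"
  shows "phi_seminorm \<phi> (f + g) \<le> phi_seminorm \<phi> f + phi_seminorm \<phi> g"
proof -
  let ?A = "Poly_Mapping.keys f \<union> Poly_Mapping.keys g"
  have "phi_seminorm \<phi> (f + g) = (\<Sum>s\<in>?A. \<bar>Poly_Mapping.lookup (f + g) s\<bar> * \<phi> s)"
    by (intro phi_seminorm_superset keys_add) auto
  also have "\<dots> \<le> (\<Sum>s\<in>?A. \<bar>Poly_Mapping.lookup f s\<bar> * \<phi> s + \<bar>Poly_Mapping.lookup g s\<bar> * \<phi> s)"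
    using assms by (intro sum_mono) (simp add: lookup_add distrib_right[symmetric] mult_right_mono)
  finally show ?thesis
    by (simp add: sum.distrib phi_seminorm_superset[of ?A f] phi_seminorm_superset[of ?A g])
qed


lemma poly_mapping_eq_sum_single:
  "f = (\<Sum>s\<in>Poly_Mapping.keys f. Poly_Mapping.single s (Poly_Mapping.lookup f s))"
  by (rule poly_mapping_eqI)
    (auto simp: lookup_sum lookup_single when_def in_keys_iff sum.delta' cong: if_cong)

text \<open>Reduces the behaviour of evaluation and seminorm on products to that on
  monomials.\<close>

lemma mult_eq_sum_single:
  fixes f g :: "'a::comm_monoid_add \<Rightarrow>\<^sub>0 'b::comm_semiring_1"
  shows "f * g = (\<Sum>s\<in>Poly_Mapping.keys f. \<Sum>t\<in>Poly_Mapping.keys g.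
    Poly_Mapping.single (s + t) (Poly_Mapping.lookup f s * Poly_Mapping.lookup g t))"
  by (subst poly_mapping_eq_sum_single[of f], subst poly_mapping_eq_sum_single[of g])
    (simp only: sum_product mult_single)

lemma phi_seminorm_zero: "phi_seminorm \<phi> 0 = 0" and poly_eval_zero: "poly_eval 0 x = 0"
  by (simp_all add: phi_seminorm_def poly_eval_def)

lemma phi_seminorm_sum:
  assumes "\<And>s. \<phi> s \<ge> 0"
  shows "phi_seminorm \<phi> (\<Sum>i\<in>A. F i) \<le> (\<Sum>i\<in>A. phi_seminorm \<phi> (F i))"
  by (induction A rule: infinite_finite_induct)
    (auto simp: phi_seminorm_zero intro: order_trans[OF phi_seminorm_add[OF assms]])

lemma poly_eval_sum: "poly_eval (\<Sum>i\<in>A. F i) x = (\<Sum>i\<in>A. poly_eval (F i) x)"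
  by (induction A rule: infinite_finite_induct) (auto simp: poly_eval_zero poly_eval_add)

lemma monomial_eval_add: "monomial_eval x (s + t) = monomial_eval x s * monomial_eval x t"
  by (simp add: monomial_eval_def power_add prod.distrib)

lemma poly_eval_mult: "poly_eval (f * g) x = poly_eval f x * poly_eval g x"
  unfolding mult_eq_sum_single[of f g] poly_eval_sum poly_eval_single
  by (simp add: poly_eval_def sum_product monomial_eval_add mult_ac)

lemma phi_seminorm_mult:
  assumes "absolute_value \<phi>"
  shows "phi_seminorm \<phi> (f * g) \<le> phi_seminorm \<phi> f * phi_seminorm \<phi> g"
proof -
  have nonneg: "\<phi> s \<ge> 0" and mult: "\<phi> (s + t) \<le> \<phi> s * \<phi> t" for s t
    using assms by (auto simp: absolute_value_def)
  have "phi_seminorm \<phi> (f * g) \<le> (\<Sum>s\<in>Poly_Mapping.keys f. \<Sum>t\<in>Poly_Mapping.keys g.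
      phi_seminorm \<phi> (Poly_Mapping.single (s + t) (Poly_Mapping.lookup f s * Poly_Mapping.lookup g t)))"
    unfolding mult_eq_sum_single[of f g]
    by (intro order_trans[OF phi_seminorm_sum] sum_mono phi_seminorm_sum nonneg)
  also have "\<dots> \<le> (\<Sum>s\<in>Poly_Mapping.keys f. \<Sum>t\<in>Poly_Mapping.keys g.
      (\<bar>Poly_Mapping.lookup f s\<bar> * \<bar>Poly_Mapping.lookup g t\<bar>) * (\<phi> s * \<phi> t))"
    unfolding phi_seminorm_single abs_mult by (intro sum_mono mult_left_mono mult) auto
  also have "\<dots> = phi_seminorm \<phi> f * phi_seminorm \<phi> g"
    by (simp add: phi_seminorm_def sum_product mult_ac)
  finally show ?thesis .
qed

lemma phi_seminorm_scale:
  "phi_seminorm \<phi> (Poly_Mapping.single 0 r * f) = \<bar>r\<bar> * phi_seminorm \<phi> f"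
proof -
  have lookup: "Poly_Mapping.lookup (Poly_Mapping.single 0 r * f) s = r * Poly_Mapping.lookup f s" for s
    by (simp add: mult_map_scale_conv_mult[symmetric] map.rep_eq when_def)
  have "phi_seminorm \<phi> (Poly_Mapping.single 0 r * f)
      = (\<Sum>s\<in>Poly_Mapping.keys f. \<bar>r * Poly_Mapping.lookup f s\<bar> * \<phi> s)"
    \<comment> \<open>For \<open>r = 0\<close> the product has no keys, so its sum is extended to
      the keys of \<open>f\<close>.\<close>
    by (subst phi_seminorm_superset[of "Poly_Mapping.keys f"]) (auto simp: lookup in_keys_iff)
  then show ?thesis by (simp add: phi_seminorm_def abs_mult sum_distrib_left mult.assoc)
qed

lemma seminormed_algebra_phi:
  assumes "absolute_value \<phi>"
  shows "seminormed_algebra (Poly_Mapping.single 0) (phi_seminorm \<phi>)"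
proof
  show "phi_seminorm \<phi> f \<ge> 0" for f
    using assms by (auto simp: phi_seminorm_def absolute_value_def intro!: sum_nonneg)
qed (use assms in \<open>auto simp: single_add mult_single phi_seminorm_scale phi_seminorm_mult
  absolute_value_def intro: phi_seminorm_add\<close>)

section \<open>Bounded characters of the polynomial ring are point evaluations\<close>

lemma exponent_eq_sum_axis: "(s :: nat ^ 'n) = (\<Sum>i\<in>UNIV. axis i (s $ i))"
  by (simp add: vec_eq_iff axis_def)

text \<open>The exponents form the free commutative monoid on the unit vectors
  \<open>axis i 1\<close>, so the values there determine \<open>\<mu>\<close>.\<close>

lemma multiplicative_eq_monomial_eval:
  fixes \<mu> :: "nat ^ 'n \<Rightarrow> real"
  assumes "\<mu> 0 = 1" "\<And>s t. \<mu> (s + t) = \<mu> s * \<mu> t"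
  shows "\<mu> s = monomial_eval (\<chi> i. \<mu> (axis i 1)) s"
proof -
  have axis: "\<mu> (axis i k) = \<mu> (axis i 1) ^ k" for i k
  proof (induction k)
    case 0
    have "axis i 0 = (0 :: nat ^ 'n)" by simp
    then show ?case by (simp only: assms(1) power_0)
  next
    case (Suc k)
    have "axis i (Suc k) = (axis i 1 + axis i k :: nat ^ 'n)" by (simp add: vec_eq_iff axis_def)
    then show ?case using Suc assms(2) by simp
  qed
  have "\<mu> (\<Sum>i\<in>A. F i) = (\<Prod>i\<in>A. \<mu> (F i))" for A and F :: "'n \<Rightarrow> nat ^ 'n"
    by (induction A rule: infinite_finite_induct) (auto simp: assms)
  then have "\<mu> s = (\<Prod>i\<in>UNIV. \<mu> (axis i (s $ i)))"
    using exponent_eq_sum_axis[of s] by metis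
  then show ?thesis by (simp only: monomial_eval_def vec_lambda_beta axis[symmetric])
qed

context
  fixes \<phi> :: "nat ^ 'n \<Rightarrow> real"
  assumes \<phi>: "absolute_value \<phi>"
begin

interpretation seminormed_algebra "Poly_Mapping.single 0" "phi_seminorm \<phi>"
  using \<phi> by (rule seminormed_algebra_phi)

lemma poly_eval_character:
  assumes "x \<in> K_set \<phi>"
  shows "character (\<lambda>f. poly_eval f x)" "\<bar>poly_eval f x\<bar> \<le> phi_seminorm \<phi> f"
proof -
  show "character (\<lambda>f. poly_eval f x)"
    by (simp add: character_def poly_eval_add poly_eval_mult poly_eval_single)
      (simp add: monomial_eval_def)
  show "\<bar>poly_eval f x\<bar> \<le> phi_seminorm \<phi> f"
    unfolding poly_eval_def phi_seminorm_def
    by (intro order_trans[OF sum_abs] sum_mono)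
      (use assms in \<open>auto simp: abs_mult K_set_def intro: mult_left_mono\<close>)
qed

text \<open>The coordinates of \<open>x\<close> are the values of \<open>L\<close> at the variables.
  Since a monomial with exponent \<open>s\<close> has seminorm \<open>\<phi> s\<close>, the bound on
  \<open>L\<close> at monomials says exactly that \<open>x\<close> lies in
  \<open>K_set \<phi>\<close>.\<close>

lemma character_eq_poly_eval:
  assumes L: "character L" "\<And>f. \<bar>L f\<bar> \<le> phi_seminorm \<phi> f"
  obtains x where "x \<in> K_set \<phi>" "L = (\<lambda>f. poly_eval f x)"
proof -
  have Ladd: "L (f + g) = L f + L g" and Lmult: "L (f * g) = L f * L g"
    and Lc: "L (Poly_Mapping.single 0 r) = r" for f g r
    using L(1) unfolding character_def by auto
  define x :: "real ^ 'n" where "x = (\<chi> i. L (Poly_Mapping.single (axis i 1) 1))"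
  have mon: "L (Poly_Mapping.single s 1) = monomial_eval x s" for s
    unfolding x_def
    by (rule multiplicative_eq_monomial_eval) (use Lc[of 1] in \<open>simp_all add: Lmult[symmetric] mult_single\<close>)
  have single: "L (Poly_Mapping.single s r) = poly_eval (Poly_Mapping.single s r) x" for s r
    using Lmult[of "Poly_Mapping.single 0 r" "Poly_Mapping.single s 1"]
    by (simp add: mult_single Lc mon poly_eval_single)
  have Lsum: "L (\<Sum>i\<in>A. F i) = (\<Sum>i\<in>A. L (F i))" for A and F :: "nat ^ 'n \<Rightarrow> 'n rpoly"
    by (induction A rule: infinite_finite_induct) (use Lc[of 0] in \<open>auto simp: Ladd\<close>)
  have "L f = poly_eval f x" for f
  proof -
    let ?F = "\<Sum>s\<in>Poly_Mapping.keys f. Poly_Mapping.single s (Poly_Mapping.lookup f s)"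
    have "L ?F = poly_eval ?F x" by (simp only: Lsum single poly_eval_sum)
    then show ?thesis by (simp only: poly_mapping_eq_sum_single[symmetric])
  qed
  moreover have "x \<in> K_set \<phi>"
    unfolding K_set_def
  proof (intro CollectI allI)
    fix s
    show "\<bar>monomial_eval x s\<bar> \<le> \<phi> s"
      using L(2)[of "Poly_Mapping.single s 1"] by (simp add: mon phi_seminorm_single)
  qed
  ultimately show thesis using that by blast
qed

text \<open>Seminorm balls are open by the triangle inequality, and every open set around
  \<open>f\<close> contains a ball centred at \<open>f\<close>.\<close>

lemma closure_of_phi_topology: "phi_topology \<phi> closure_of S = seminorm_closure S"
proof (intro set_eqI iffI)
  fix f
  assume f: "f \<in> phi_topology \<phi> closure_of S"
  show "f \<in> seminorm_closure S"
    unfolding seminorm_closure_def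
  proof (intro CollectI allI impI)
    fix e :: real assume "e > 0"
    let ?B = "{g. phi_seminorm \<phi> (g - f) < e}"
    have "openin (phi_topology \<phi>) ?B"
      unfolding openin_phi_topology
    proof
      fix g assume g: "g \<in> ?B"
      have "h \<in> ?B" if "phi_seminorm \<phi> (h - g) < e - phi_seminorm \<phi> (g - f)" for h
        using p_add[of "h - g" "g - f"] that by simp
      then show "\<exists>e'>0. \<forall>h. phi_seminorm \<phi> (h - g) < e' \<longrightarrow> h \<in> ?B"
        using g by (intro exI[of _ "e - phi_seminorm \<phi> (g - f)"]) auto
    qed
    moreover have "f \<in> ?B" using \<open>e > 0\<close> by (simp add: p_zero)
    ultimately have "\<exists>g. g \<in> S \<and> g \<in> ?B"
      using f[unfolded in_closure_of] by (elim conjE allE[of _ ?B]) simp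
    then show "\<exists>g\<in>S. phi_seminorm \<phi> (g - f) < e" by blast
  qed
next
  fix f
  assume f: "f \<in> seminorm_closure S"
  show "f \<in> phi_topology \<phi> closure_of S"
    unfolding in_closure_of
  proof (intro conjI allI impI)
    fix T assume T: "f \<in> T \<and> openin (phi_topology \<phi>) T"
    then obtain e where e: "e > 0" "\<And>g. phi_seminorm \<phi> (g - f) < e \<Longrightarrow> g \<in> T"
      unfolding openin_phi_topology by blast
    obtain g where "g \<in> S" "phi_seminorm \<phi> (g - f) < e"
      using f e(1) unfolding seminorm_closure_def by blast
    then show "\<exists>g. g \<in> S \<and> g \<in> T" using e(2) by blast
  qed (simp add: topspace_phi_topology)
qed

text \<open>The characters bounded by the seminorm are exactly the evaluations at points of
  \<open>K_set \<phi>\<close>.\<close>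

lemma closure_of_sums_of_powers:
  assumes "d \<ge> 1"
  shows "phi_topology \<phi> closure_of sums_of_powers (2 * d) = Pos (K_set \<phi>)"
proof -
  have "phi_topology \<phi> closure_of sums_of_powers (2 * d)
      = {f. \<forall>L. character L \<and> (\<forall>a. \<bar>L a\<bar> \<le> phi_seminorm \<phi> a) \<longrightarrow> L f \<ge> 0}"
    unfolding closure_of_phi_topology by (rule closure_sums_of_powers) (use assms in auto)
  also have "\<dots> = Pos (K_set \<phi>)"
    unfolding Pos_def using poly_eval_character character_eq_poly_eval by (smt (verit) Collect_cong)
  finally show ?thesis .
qed

end

theorem corollary3p4:
  fixes \<phi> :: "nat ^ 'n \<Rightarrow> real" and d :: nat
  assumes "d \<ge> 1"
    and "absolute_value \<phi>"
  shows "phi_topology \<phi> closure_of sums_of_powers (2 * d) = Pos (K_set \<phi>)"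
  using assms(2,1) by (rule closure_of_sums_of_powers)

end
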